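(* Let $m\ge 1$ and let $D$ be a strong digraph of order $n=2m+1\geq 3$ which contains a (directed) cycle of length $n-1$. Then at least one of the following holds: (i) $D$ contains a cycle containing all vertices $v$ with $d^+(v)\ge m$ and $d^-(v)\ge m$; (ii) $D$ is isomorphic to $D_5$ or to $D_7$, or $D$ is isomorphic to a member of $L_1\cup L_2$; (iii) $D$ contains a spanning subdigraph isomorphic to $K^*_{m,m+1}$, and $D$ is isomorphic to a spanning subdigraph of $[K_m+\overline K_{m+1}]^*$; (iv) $D$ contains a cycle $C=x_1x_2\ldots x_{2m}x_1$ of length $n-1$ (indices taken modulo $2m$) with the following property: if $x$ is the vertex of $D$ not on $C$ and $x$ is not adjacent to the vertices $x_{l_1},x_{l_2},\ldots,x_{l_j}$ of $C$, where $j\ge 3$, then for every $i\in[1,j]$ we have $x_{l_i-1}x\in A(D)$, $xx_{l_i+1}\in A(D)$, $N^+(x)=N^+(x_{l_i})$ and $N^-(x)=N^-(x_{l_i})$; in particular, $\{x_{l_1},x_{l_2},\ldots,x_{l_j},x\}$ is an independent set of vertices.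
   Context: Digraphs are finite, without loops and without multiple arcs (opposite arcs $uv,vu$ allowed). $A(D)$ is the arc set; $N^+(v)$, $N^-(v)$ are the out- and in-neighbourhoods of $v$, and $d^\pm(v)=|N^\pm(v)|$. Two distinct vertices are adjacent if at least one arc joins them. $D$ is strong if for every ordered pair of distinct vertices there is a directed path from the first to the second. For $a\le b$ integers, $[a,b]=\{a,a+1,\ldots,b\}$. $D_7$: vertex set $\{x_1,x_2,x_3,x_4,x_5,x,y\}$ with $N^+(x_1)=\{x_2,x_5,y\}$, $N^+(x_2)=\{x_3,x_4,y\}$, $N^+(x_3)=\{x_2,x_4,x\}$, $N^+(x_4)=\{x_3,x_5,x\}$, $N^+(x_5)=\{x_1,x,y\}$, $N^+(x)=\{x_1,x_2,x_3\}$, $N^+(y)=\{x_1,x_4,x_5\}$. $D_5$: vertex set $\{x_1,x_2,x_3,x,y\}$ with $N^+(x_1)=\{x_2,y\}$, $N^+(x_2)=\{x_3,x\}$, $N^+(x_3)=\{x,y\}$, $N^+(x)=\{x_1,x_2\}$, $N^+(y)=\{x_1,x_3\}$. $L_1$ is the set of the three digraphs obtained from $D_5$ by adding the arc $x_1x_3$, or the arc $x_3x_1$, or both. $L_2$ is the set of digraphs $D$ with vertex set $\{x_1,\ldots,x_{2m},x\}$ such that: $D$ contains the cycle $x_1x_2\ldots x_{2m}x_1$ and $x$, $x_{2m}$ are not adjacent; $N^+(x)=N^+(x_{2m})=\{x_1,\ldots,x_m\}$ and $N^-(x)=N^-(x_{2m})=\{x_m,x_{m+1},\ldots,x_{2m-1}\}$;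 there is no arc from $\{x_1,\ldots,x_{m-1}\}$ to $\{x_{m+1},\ldots,x_{2m-1}\}$; the induced subdigraphs on $\{x_1,\ldots,x_m\}$ and on $\{x_m,\ldots,x_{2m-1}\}$ are arbitrary, and any number of arcs from $\{x_{m+1},\ldots,x_{2m-1}\}$ to $\{x_1,\ldots,x_m\}$ may be present. For an undirected graph $G$, $G^*$ is the symmetric digraph obtained by replacing each edge $uv$ by the two arcs $uv,vu$. $K_m$ is the complete graph on $m$ vertices, $\overline K_{m+1}$ the edgeless graph on $m+1$ vertices, $K_{m,m+1}$ the complete bipartite graph with parts of sizes $m$ and $m+1$, and $K_m+\overline K_{m+1}$ the join of $K_m$ and $\overline K_{m+1}$ (disjoint union plus all edges between the two). *)

theory Defs
  imports "Graph_Theory.Graph_Theory"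
begin

text \<open>
  Digraphs are values \<open>D :: 'a pair_pre_digraph\<close> satisfying \<open>pair_digraph D\<close>: finite, loop-free, and
  without multiple arcs since the arcs are a set of pairs. Strong connectivity, degrees, cycles,
  spanning subdigraphs and isomorphism are the notions of \<open>Graph_Theory\<close>, which apply to
  \<open>with_proj D\<close>.
\<close>

definition out_nbrs :: "'a pair_pre_digraph \<Rightarrow> 'a \<Rightarrow> 'a set" where
  "out_nbrs D v = {w. (v, w) \<in> parcs D}"

definition in_nbrs :: "'a pair_pre_digraph \<Rightarrow> 'a \<Rightarrow> 'a set" where
  "in_nbrs D v = {u. (u, v) \<in> parcs D}"

lemma out_degree_eq_card_out_nbrs:
  "out_degree (with_proj D) v = card (out_nbrs D v)"
proof -
  have "bij_betw (Pair v) (out_nbrs D v) (out_arcs (with_proj D) v)"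
    by (auto simp: bij_betw_def inj_on_def out_nbrs_def out_arcs_def)
  then show ?thesis
    by (simp add: out_degree_def bij_betw_same_card)
qed

lemma in_degree_eq_card_in_nbrs:
  "in_degree (with_proj D) v = card (in_nbrs D v)"
proof -
  have "bij_betw (\<lambda>u. (u, v)) (in_nbrs D v) (in_arcs (with_proj D) v)"
    by (auto simp: bij_betw_def inj_on_def in_nbrs_def in_arcs_def)
  then show ?thesis
    by (simp add: in_degree_def bij_betw_same_card)
qed

definition adjacent :: "'a pair_pre_digraph \<Rightarrow> 'a \<Rightarrow> 'a \<Rightarrow> bool" where
  "adjacent D u v \<longleftrightarrow> (u, v) \<in> parcs D \<or> (v, u) \<in> parcs D"

definition independent_in :: "'a pair_pre_digraph \<Rightarrow> 'a set \<Rightarrow> bool" where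
  "independent_in D S \<longleftrightarrow> S \<subseteq> pverts D \<and> (\<forall>u\<in>S. \<forall>v\<in>S. u \<noteq> v \<longrightarrow> \<not> adjacent D u v)"

text \<open>
  Cycles are given by their cyclic vertex sequence: the list \<open>[x\<^sub>1, \<dots>, x\<^sub>k]\<close> has the arc list
  \<open>[(x\<^sub>1, x\<^sub>2), \<dots>, (x\<^sub>k, x\<^sub>1)]\<close>. Its length is the number of vertices, and loop-freeness forces
  \<open>k \<ge> 2\<close>.
\<close>

definition cycle_of :: "'a pair_pre_digraph \<Rightarrow> 'a list \<Rightarrow> bool" where
  "cycle_of D xs \<longleftrightarrow> pre_digraph.cycle (with_proj D) (zip xs (rotate1 xs))"

lemma cycle_of_iff:
  assumes "pair_wf_digraph D"
  shows "cycle_of D xs \<longleftrightarrow>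
    xs \<noteq> [] \<and> distinct xs \<and>
    (\<forall>i<length xs. (xs ! i, xs ! ((i + 1) mod length xs)) \<in> parcs D)"
proof (cases xs)
  case Nil
  then show ?thesis by (simp add: cycle_of_def pre_digraph.cycle_def)
next
  case (Cons a as)
  interpret pair_wf_digraph D by (fact assms)
  have cas: "cas u (zip (a # as) (as @ [b])) v \<longleftrightarrow> a = u \<and> b = v" for u v a b as
    by (induction as arbitrary: a u) simp_all
  have vs: "awalk_verts u (zip (a # as) (as @ [b])) = a # as @ [b]" for u a b as
    by (induction as arbitrary: a u) simp_all
  have arcs: "set (zip xs (rotate1 xs)) \<subseteq> parcs D \<longleftrightarrow>
      (\<forall>i<length xs. (xs ! i, xs ! ((i + 1) mod length xs)) \<in> parcs D)"
    by (auto simp: set_zip nth_rotate1)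
  have "a \<in> pverts D" if "set (zip xs (rotate1 xs)) \<subseteq> parcs D"
  proof -
    have "(a, hd (as @ [a])) \<in> set (zip xs (rotate1 xs))"
      unfolding Cons by (cases as) auto
    with that have "(a, hd (as @ [a])) \<in> parcs D" by (rule subsetD)
    then show ?thesis by (rule in_arcsD1)
  qed
  moreover have "cycle_of D xs \<longleftrightarrow>
      a \<in> pverts D \<and> set (zip xs (rotate1 xs)) \<subseteq> parcs D \<and> distinct (as @ [a])"
    unfolding cycle_of_def cycle_def awalk_def Cons rotate1.simps cas vs
    by (cases as) (simp_all add: conj_ac)
  moreover have "distinct (as @ [a]) \<longleftrightarrow> distinct xs"
    using Cons by auto
  ultimately show ?thesis
    unfolding arcs using Cons by blast
qed

datatype vtx = Xi nat | X | Y

definition D7 :: "vtx pair_pre_digraph" where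
  "D7 = \<lparr> pverts = {Xi 1, Xi 2, Xi 3, Xi 4, Xi 5, X, Y},
     parcs = {Xi 1} \<times> {Xi 2, Xi 5, Y} \<union> {Xi 2} \<times> {Xi 3, Xi 4, Y} \<union>
             {Xi 3} \<times> {Xi 2, Xi 4, X} \<union> {Xi 4} \<times> {Xi 3, Xi 5, X} \<union>
             {Xi 5} \<times> {Xi 1, X, Y} \<union>
             {X} \<times> {Xi 1, Xi 2, Xi 3} \<union> {Y} \<times> {Xi 1, Xi 4, Xi 5} \<rparr>"

definition D5 :: "vtx pair_pre_digraph" where
  "D5 = \<lparr> pverts = {Xi 1, Xi 2, Xi 3, X, Y},
     parcs = {Xi 1} \<times> {Xi 2, Y} \<union> {Xi 2} \<times> {Xi 3, X} \<union> {Xi 3} \<times> {X, Y} \<union>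
             {X} \<times> {Xi 1, Xi 2} \<union> {Y} \<times> {Xi 1, Xi 3} \<rparr>"

definition L1 :: "vtx pair_pre_digraph set" where
  "L1 = (\<lambda>A. \<lparr> pverts = pverts D5, parcs = parcs D5 \<union> A \<rparr>) `
     {{(Xi 1, Xi 3)}, {(Xi 3, Xi 1)}, {(Xi 1, Xi 3), (Xi 3, Xi 1)}}"

definition L2 :: "nat \<Rightarrow> vtx pair_pre_digraph set" where
  "L2 m = {D. pair_digraph D \<and>
     pverts D = Xi ` {1..2*m} \<union> {X} \<and>
     cycle_of D (map Xi [1..<2*m + 1]) \<and>
     \<not> adjacent D X (Xi (2*m)) \<and>
     out_nbrs D X = Xi ` {1..m} \<and> out_nbrs D (Xi (2*m)) = Xi ` {1..m} \<and>
     in_nbrs D X = Xi ` {m..2*m - 1} \<and> in_nbrs D (Xi (2*m)) = Xi ` {m..2*m - 1} \<and>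
     (\<forall>i\<in>{1..m - 1}. \<forall>j\<in>{m + 1..2*m - 1}. (Xi i, Xi j) \<notin> parcs D)}"

text \<open>An undirected graph is a pair of a vertex set and a set of two-element edges.\<close>

type_synonym 'a ugraph = "'a set \<times> 'a set set"

definition complete_ugraph :: "nat \<Rightarrow> nat ugraph" where
  "complete_ugraph n = ({..<n}, {{u, v} |u v. u < n \<and> v < n \<and> u \<noteq> v})"

definition edgeless_ugraph :: "nat \<Rightarrow> nat ugraph" where
  "edgeless_ugraph n = ({..<n}, {})"

definition complete_bipartite_ugraph :: "nat \<Rightarrow> nat \<Rightarrow> (nat + nat) ugraph" where
  "complete_bipartite_ugraph p q = ({..<p} <+> {..<q}, {{Inl u, Inr v} |u v. u < p \<and> v < q})"

definition ugraph_join :: "'a ugraph \<Rightarrow> 'b ugraph \<Rightarrow> ('a + 'b) ugraph" where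
  "ugraph_join G H =
     (fst G <+> fst H,
      (`) Inl ` snd G \<union> (`) Inr ` snd H \<union> {{Inl u, Inr v} |u v. u \<in> fst G \<and> v \<in> fst H})"

definition star :: "'a ugraph \<Rightarrow> 'a pair_pre_digraph" where
  "star G = \<lparr> pverts = fst G, parcs = {(u, v). {u, v} \<in> snd G} \<rparr>"

text \<open>
  \<open>nonneighbours_twins D xs x\<close> is the property of a cycle \<open>xs\<close> and a vertex \<open>x\<close> off it that any (at
  least three) vertices \<open>xs ! l\<close>, \<open>l \<in> I\<close>, not adjacent to \<open>x\<close> are twins of \<open>x\<close>. It is an implication,
  so it holds vacuously if \<open>x\<close> has at most two non-neighbours on the cycle. Positions are counted
  from 0, and \<open>l + length xs - 1\<close> avoids truncated subtraction in the cyclic predecessor of \<open>l\<close>.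
\<close>

definition nonneighbours_twins :: "'a pair_pre_digraph \<Rightarrow> 'a list \<Rightarrow> 'a \<Rightarrow> bool" where
  "nonneighbours_twins D xs x \<longleftrightarrow>
     (\<forall>I \<subseteq> {..<length xs}. 3 \<le> card I \<and> (\<forall>l\<in>I. \<not> adjacent D x (xs ! l)) \<longrightarrow>
       (\<forall>l\<in>I. (xs ! ((l + length xs - 1) mod length xs), x) \<in> parcs D \<and>
              (x, xs ! ((l + 1) mod length xs)) \<in> parcs D \<and>
              out_nbrs D x = out_nbrs D (xs ! l) \<and>
              in_nbrs D x = in_nbrs D (xs ! l)) \<and>
       independent_in D (insert x ((!) xs ` I)))"

end

theory Submission
  imports Defs "HOL-Library.Multiset"
begin

text \<open>
  Suppose (i) and (iv) fail. Then \<open>D\<close> is not Hamiltonian, and every vertex \<open>v\<close> missed by a cycle of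
  length \<open>2m\<close> has both degrees at least \<open>m\<close>; since \<open>v\<close> cannot be inserted into that cycle, exactly
  one of \<open>uv\<close>, \<open>vw\<close> is an arc for each arc \<open>uw\<close> of the cycle. Hence a non-neighbour of \<open>v\<close> on the
  cycle can be exchanged with \<open>v\<close>, and so is missed by a cycle of length \<open>2m\<close> itself. Three pairwise
  non-adjacent vertices obtained in this way are twins, so by the failure of (iv) each missed vertex
  has at least three non-neighbours, and these are pairwise adjacent. Playing the exchanges off
  against each other (non-neighbours of \<open>x\<close>, and non-neighbours of these) always yields a
  Hamiltonian cycle. Thus (i) or (iv) holds in every case: (iv) is vacuous when \<open>x\<close> has at most two
  non-neighbours, and this absorbs the exceptional digraphs of (ii).
\<close>

section \<open>Cyclic vertex lists on a prescribed vertex set\<close>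

text \<open>The arcs are a bare relation and the vertex set is explicit, so that reversing all arcs
  and deleting a vertex are mere instantiations. \<open>successively\<close> with a separate closing
  arc replaces modular indices: a concatenation of segments then reduces to its junction
  arcs.\<close>

definition ham_cycle_on :: "('a \<Rightarrow> 'a \<Rightarrow> bool) \<Rightarrow> 'a set \<Rightarrow> 'a list \<Rightarrow> bool" where
  "ham_cycle_on E A xs \<longleftrightarrow>
     xs \<noteq> [] \<and> distinct xs \<and> set xs = A \<and> successively E xs \<and> E (last xs) (hd xs)"

lemma ham_cycle_on_append_commute:
  assumes "ham_cycle_on E A (xs @ ys)"
  shows "ham_cycle_on E A (ys @ xs)"
  using assms
  by (cases "xs = []"; cases "ys = []") (auto simp: ham_cycle_on_def successively_append_iff)

lemma ham_cycle_on_converse: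
  "ham_cycle_on (\<lambda>u v. E v u) A xs \<longleftrightarrow> ham_cycle_on E A (rev xs)"
  by (cases "xs = []") (auto simp: ham_cycle_on_def hd_rev last_rev)

lemma ham_cycle_on_split:
  assumes "ham_cycle_on E A xs" "y \<in> A" "z \<in> A" "y \<noteq> z"
  obtains P Q where "ham_cycle_on E A (y # P @ z # Q)"
proof -
  have "y \<in> set xs" using assms by (auto simp: ham_cycle_on_def)
  then obtain S T where "xs = S @ y # T" by (auto simp: in_set_conv_decomp)
  then have c: "ham_cycle_on E A (y # T @ S)"
    using assms(1) ham_cycle_on_append_commute[of E A S "y # T"] by simp
  then have "z \<in> set (T @ S)" using assms by (auto simp: ham_cycle_on_def)
  then obtain P Q where "T @ S = P @ z # Q" by (meson split_list)
  with c show thesis using that by simp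
qed

lemma ham_cycle_on_split3:
  assumes "ham_cycle_on E A xs" "a \<in> A" "b \<in> A" "c \<in> A" "a \<noteq> b" "a \<noteq> c" "b \<noteq> c"
  obtains P Q R where
    "ham_cycle_on E A (a # P @ b # Q @ c # R) \<or> ham_cycle_on E A (a # P @ c # Q @ b # R)"
proof -
  obtain P Q where pq: "ham_cycle_on E A (a # P @ b # Q)"
    using ham_cycle_on_split[of E A xs a b] assms by blast
  have "c \<in> set P \<or> c \<in> set Q" using pq assms by (auto simp: ham_cycle_on_def)
  then show thesis
  proof
    assume "c \<in> set P"
    then obtain S T where "P = S @ c # T" by (auto simp: in_set_conv_decomp)
    then show thesis using that[of S T Q] pq by simp
  next
    assume "c \<in> set Q"
    then obtain S T where "Q = S @ c # T" by (auto simp: in_set_conv_decomp)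
    then show thesis using that[of P S T] pq by simp
  qed
qed

text \<open>Somewhere along the list the truth value of \<open>E v\<close> rises from false to true;
  the vertex \<open>d\<close> just before the rise has no arc to \<open>v\<close> either, by the
  exactly-one condition.\<close>

lemma successively_xor_rise:
  assumes "successively (\<lambda>u w. E u v \<noteq> E v w) (Q @ [c])"
    and "\<not> E v (hd (Q @ [c]))" and "E v c"
  obtains Q1 d Q2 where "Q = Q1 @ d # Q2" "\<not> E v d" "\<not> E d v"
  using assms
proof (induction Q arbitrary: thesis)
  case Nil
  then show ?case by simp
next
  case (Cons q Q)
  show ?case
  proof (cases "E v (hd (Q @ [c]))")
    case True
    then have "\<not> E q v" using Cons.prems by (auto simp: successively_Cons)
    then show ?thesis using Cons.prems(1)[of "[]" q Q] Cons.prems by simp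
  next
    case False
    obtain Q1 d Q2 where "Q = Q1 @ d # Q2" "\<not> E v d" "\<not> E d v"
      using Cons.IH Cons.prems False by (auto simp: successively_Cons)
    then show ?thesis using Cons.prems(1)[of "q # Q1" d Q2] by simp
  qed
qed

section \<open>Exchanging the missed vertex with a non-neighbour\<close>

text \<open>The exactly-one condition is required only at the closing arc of a list; rotating the
  list carries it to every arc of the cycle.\<close>

locale nonhamiltonian =
  fixes E :: "'a \<Rightarrow> 'a \<Rightarrow> bool" and V :: "'a set"
  assumes irrefl: "\<not> E v v"
    and nonham: "\<not> ham_cycle_on E V xs"
    and xor_closing: "v \<in> V \<Longrightarrow> ham_cycle_on E (V - {v}) xs \<Longrightarrow> E (last xs) v \<noteq> E v (hd xs)"
begin

abbreviation missed :: "'a \<Rightarrow> 'a list \<Rightarrow> bool" where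
  "missed v xs \<equiv> v \<in> V \<and> ham_cycle_on E (V - {v}) xs"

abbreviation nonadj :: "'a \<Rightarrow> 'a \<Rightarrow> bool" where
  "nonadj u v \<equiv> \<not> E u v \<and> \<not> E v u"

text \<open>The assumptions are symmetric under reversal of all arcs, so each later result also has
  a mirror image obtained by interpretation.\<close>

lemma converse: "nonhamiltonian (\<lambda>u v. E v u) V"
proof
  show "\<not> E v v" for v by (rule irrefl)
  show "\<not> ham_cycle_on (\<lambda>u v. E v u) V xs" for xs
    using nonham ham_cycle_on_converse[of E V xs] by simp
  show "E v (last xs) \<noteq> E (hd xs) v"
    if "v \<in> V" "ham_cycle_on (\<lambda>u v. E v u) (V - {v}) xs" for v xs
    using xor_closing[of v "rev xs"] that ham_cycle_on_converse[of E "V - {v}" xs]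
    by (auto simp: hd_rev last_rev)
qed

lemma missed_rotate: "missed v (xs @ ys) \<Longrightarrow> missed v (ys @ xs)"
  using ham_cycle_on_append_commute by blast

lemma missed_xor:
  assumes "missed v xs"
  shows "successively (\<lambda>u w. E u v \<noteq> E v w) xs \<and> E (last xs) v \<noteq> E v (hd xs)"
proof
  show "E (last xs) v \<noteq> E v (hd xs)" using assms xor_closing by blast
  have "E (xs ! i) v \<noteq> E v (xs ! Suc i)" if "Suc i < length xs" for i
  proof -
    have "missed v (drop (Suc i) xs @ take (Suc i) xs)"
      using missed_rotate[of v "take (Suc i) xs" "drop (Suc i) xs"] assms by simp
    then have "E (last (drop (Suc i) xs @ take (Suc i) xs)) v
        \<noteq> E v (hd (drop (Suc i) xs @ take (Suc i) xs))"
      using xor_closing by blast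
    then show ?thesis using that
      by (auto simp: take_Suc_conv_app_nth hd_drop_conv_nth)
  qed
  then show "successively (\<lambda>u w. E u v \<noteq> E v w) xs"
    by (simp add: successively_conv_nth)
qed

text \<open>As \<open>v\<close> and \<open>y\<close> are not adjacent, the exactly-one condition
  forces an arc from the predecessor of \<open>y\<close> to \<open>v\<close> and one from
  \<open>v\<close> to the successor of \<open>y\<close>, so \<open>v\<close> can take the place of
  \<open>y\<close>.\<close>

lemma missed_swap:
  assumes "missed v (P @ y # Q)" "nonadj v y" "P \<noteq> [] \<or> Q \<noteq> []"
  shows "missed y (P @ v # Q)"
proof -
  have rot: "missed v (y # Q @ P)"
    using missed_rotate[of v P "y # Q"] assms(1) by simp
  have "Q @ P \<noteq> []" using assms(3) by auto
  then obtain q R where qR: "Q @ P = q # R" by (cases "Q @ P") auto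
  have "E v q" "E (last (q # R)) v"
    using missed_xor[OF rot] assms(2) by (simp_all add: qR successively_Cons)
  moreover have "y \<in> V - {v}" "distinct (y # q # R)" "insert y (set (q # R)) = V - {v}"
    "successively E (q # R)"
    using rot by (auto simp: qR ham_cycle_on_def)
  moreover from this have "insert v (set (q # R)) = V - {y}" using assms(1) by auto
  ultimately have "missed y (v # q # R)"
    by (auto simp: ham_cycle_on_def successively_Cons)
  then show ?thesis
    using missed_rotate[of y "v # Q" P] qR by simp
qed

text \<open>This is the source of all contradictions below: a candidate Hamiltonian cycle is written
  as a list of segments, and the multiset equation certifies that it visits each vertex
  once.\<close>

lemma no_ham_rearrangement:
  assumes "missed v xs" "mset ys = mset (v # xs)"
  shows "\<not> (successively E ys \<and> E (last ys) (hd ys))"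
proof
  assume *: "successively E ys \<and> E (last ys) (hd ys)"
  have "set ys = V"
    using assms(1) mset_eq_setD[OF assms(2)] by (auto simp: ham_cycle_on_def)
  moreover have "distinct ys"
    using assms mset_eq_imp_distinct_iff[OF assms(2)] by (simp add: ham_cycle_on_def)
  moreover have "ys \<noteq> []" using assms(2) by auto
  ultimately show False using * nonham[of ys] by (simp add: ham_cycle_on_def)
qed

lemma missed_arcs:
  assumes "missed v xs"
  shows "successively E xs \<and> E (last xs) (hd xs)"
  using assms by (simp add: ham_cycle_on_def)

lemmas junctions = successively_append_iff successively_Cons

section \<open>Pairwise non-adjacent triples are twins\<close>

text \<open>If \<open>y u\<close> were no arc, the exactly-one condition for \<open>y\<close> would
  give an arc to \<open>y\<close> from the vertex before \<open>u\<close>. Cutting the cycle before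
  \<open>u\<close> then lets \<open>y\<close> be reached there and \<open>x\<close> continue to
  \<open>u\<close>; the remaining junctions follow from non-adjacency.\<close>

lemma nonadj_triple_out:
  assumes C: "missed x (y # P @ z # Q)"
    and na: "nonadj x y" "nonadj x z" "nonadj y z"
    and u: "u \<in> V" "E x u"
  shows "E y u"
proof (rule ccontr)
  assume nu: "\<not> E y u"
  have Cy: "missed y (x # P @ z # Q)"
    using missed_swap[of x "[]" y "P @ z # Q"] C na by simp
  have Cz: "missed z (y # P @ x # Q)"
    using missed_swap[of x "y # P" z Q] C na by simp
  note A = missed_arcs[OF C]
  have ne: "P \<noteq> []" "Q \<noteq> []"
    using A na by (auto simp: junctions)
  note X = missed_xor[OF C] missed_xor[OF Cy] missed_xor[OF Cz]
  have "u \<noteq> x" "u \<noteq> y" "u \<noteq> z" using u na irrefl by auto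
  then have "u \<in> set P \<or> u \<in> set Q" using C u by (auto simp: ham_cycle_on_def)
  then show False
  proof
    assume "u \<in> set P"
    then obtain P1 P2 where P: "P = P1 @ P2" and P2: "P2 \<noteq> []" "hd P2 = u"
      by (metis list.discI list.sel(1) split_list)
    have P1: "P1 \<noteq> []" using A nu P2 unfolding P by (auto simp: junctions)
    have "mset (z # P1 @ y # Q @ x # P2) = mset (x # y # P @ z # Q)" unfolding P by simp
    \<comment> \<open>With all segments nonempty, every hypothesis becomes a Boolean statement about
      arcs between segment ends and named vertices, which \<open>sat\<close> decides. The later
      rearrangements follow the same scheme.\<close>
    from no_ham_rearrangement[OF C this] A X na nu u show False
      unfolding P by (simp (no_asm_use) add: junctions ne P1 P2) sat
  next
    assume "u \<in> set Q"
    then obtain Q1 Q2 where Q: "Q = Q1 @ Q2" and Q2: "Q2 \<noteq> []" "hd Q2 = u"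
      by (metis list.discI list.sel(1) split_list)
    have Q1: "Q1 \<noteq> []" using X na nu Q2 unfolding Q by (auto simp: junctions)
    have "mset (z # Q1 @ y # P @ x # Q2) = mset (x # y # P @ z # Q)" unfolding Q by simp
    from no_ham_rearrangement[OF C this] A X na nu u show False
      unfolding Q by (simp (no_asm_use) add: junctions ne Q1 Q2) sat
  qed
qed

lemma missed_converse:
  assumes "missed v (y # xs)"
  shows "v \<in> V \<and> ham_cycle_on (\<lambda>u v. E v u) (V - {v}) (y # rev xs)"
  using missed_rotate[of v "[y]" xs] assms ham_cycle_on_converse[of E "V - {v}" "y # rev xs"]
  by simp

text \<open>The two inclusions of out-neighbourhoods come from exchanging \<open>x\<close> and
  \<open>y\<close>, those of in-neighbourhoods from reversing all arcs.\<close>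

lemma nonadj_triple_twins:
  assumes C: "missed x (y # P @ z # Q)"
    and na: "nonadj x y" "nonadj x z" "nonadj y z"
    and u: "u \<in> V"
  shows "E x u = E y u \<and> E u x = E u y"
proof -
  interpret c: nonhamiltonian "\<lambda>u v. E v u" V by (rule converse)
  have C': "missed y (x # P @ z # Q)"
    using missed_swap[of x "[]" y "P @ z # Q"] C na by simp
  show ?thesis
    using nonadj_triple_out[OF C na u] nonadj_triple_out[OF C' _ na(3) na(2) u]
      c.nonadj_triple_out[of x y "rev Q" z "rev P" u]
      c.nonadj_triple_out[of y x "rev Q" z "rev P" u]
      missed_converse[OF C] missed_converse[OF C'] na u
    by auto
qed

text \<open>One non-adjacent pair \<open>u\<close>, \<open>w\<close> suffices for all non-neighbours
  \<open>z\<close> of \<open>v\<close>: since \<open>u\<close> is a twin of \<open>v\<close>, it is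
  not adjacent to \<open>z\<close>, and so \<open>z\<close> and \<open>u\<close> form such a pair
  themselves.\<close>

lemma nonadj_pair_twins:
  assumes C: "missed v xs"
    and u: "u \<in> V" "u \<noteq> v" "nonadj v u" and w: "w \<in> V" "w \<noteq> v" "nonadj v w"
    and uw: "u \<noteq> w" "nonadj u w"
    and z: "z \<in> V" "z \<noteq> v" "nonadj v z" and t: "t \<in> V"
  shows "(E v t \<longleftrightarrow> E z t) \<and> (E t v \<longleftrightarrow> E t z)"
proof -
  have twins: "(E v t \<longleftrightarrow> E y t) \<and> (E t v \<longleftrightarrow> E t y)"
    if y: "y \<in> V" "y \<noteq> v" "nonadj v y" "y' \<in> V" "y' \<noteq> v" "nonadj v y'" "y \<noteq> y'" "nonadj y y'"
      "t \<in> V" for y y' t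
  proof -
    have "y \<in> V - {v}" "y' \<in> V - {v}" using y by auto
    then obtain P Q where "ham_cycle_on E (V - {v}) (y # P @ y' # Q)"
      using ham_cycle_on_split[of E "V - {v}" xs y y'] C y(7) by blast
    then have "missed v (y # P @ y' # Q)" using C by blast
    then show ?thesis using nonadj_triple_twins[of v y P y' Q t] y by blast
  qed
  show ?thesis
  proof (cases "z = u")
    case True
    then show ?thesis using twins[of u w t] u w uw t by blast
  next
    case False
    have "nonadj u z" using twins[of u w z] u w uw z by blast
    then show ?thesis using twins[of z u t] u z False t by blast
  qed
qed

lemma missed_xor_nth:
  assumes "missed v xs" "i < length xs"
  shows "E (xs ! i) v \<noteq> E v (xs ! ((i + 1) mod length xs))"
proof (cases "Suc i < length xs")
  case True
  then show ?thesis using missed_xor[OF assms(1)] by (simp add: successively_conv_nth)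
next
  case False
  then have "Suc i = length xs" "xs \<noteq> []" using assms(2) by auto
  then show ?thesis using missed_xor[OF assms(1)]
    by (metis Suc_eq_plus1 diff_Suc_1 hd_conv_nth last_conv_nth mod_self)
qed

end

section \<open>Non-neighbours of a non-neighbour\<close>

text \<open>
  \<open>third_nonadj\<close> says that a missed vertex has at least three non-neighbours; together with
  \<open>nonadj_clique\<close> it turns out to be contradictory as soon as some vertex is missed.
\<close>

locale nonadjacent_cliques = nonhamiltonian +
  assumes nonadj_clique:
    "\<lbrakk>v \<in> V; ham_cycle_on E (V - {v}) xs; u \<in> V; w \<in> V; u \<noteq> v; w \<noteq> v; u \<noteq> w;
      nonadj v u; nonadj v w\<rbrakk> \<Longrightarrow> E u w \<or> E w u"
    and third_nonadj:
    "\<lbrakk>v \<in> V; ham_cycle_on E (V - {v}) xs\<rbrakk>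
      \<Longrightarrow> \<exists>w\<in>V. w \<noteq> v \<and> w \<noteq> p \<and> w \<noteq> q \<and> nonadj v w"
begin

lemma converse_cliques: "nonadjacent_cliques (\<lambda>u v. E v u) V"
proof -
  interpret c: nonhamiltonian "\<lambda>u v. E v u" V by (rule converse)
  show ?thesis
  proof
    show "E w u \<or> E u w"
      if "v \<in> V" "ham_cycle_on (\<lambda>u v. E v u) (V - {v}) xs" "u \<in> V" "w \<in> V"
        "u \<noteq> v" "w \<noteq> v" "u \<noteq> w" "c.nonadj v u" "c.nonadj v w" for v u w xs
      using nonadj_clique[of v "rev xs" u w] that ham_cycle_on_converse[of E "V - {v}" xs] by blast
    show "\<exists>w\<in>V. w \<noteq> v \<and> w \<noteq> p \<and> w \<noteq> q \<and> c.nonadj v w"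
      if "v \<in> V" "ham_cycle_on (\<lambda>u v. E v u) (V - {v}) xs" for v xs p q
      using third_nonadj[of v "rev xs" p q] that ham_cycle_on_converse[of E "V - {v}" xs] by blast
  qed
qed

text \<open>
  With \<open>x\<close>, \<open>y\<close>, \<open>z\<close>, \<open>w\<close> the exchange argument gives four cycles of length \<open>2m\<close>, one missing each of
  them. Their exactly-one conditions leave six unknown arcs, and the seven closed sequences below
  exclude all other values.
\<close>

lemma nonadj_path_gap:
  assumes C: "missed x (y # R @ z # S @ w # T)" and S: "S \<noteq> []"
    and na: "nonadj x y" "nonadj x z" "nonadj y w"
  shows "E y z \<and> E w x \<and> E w z \<and> \<not> E z w \<and> (E z y \<longleftrightarrow> E x w)"
proof -
  have Cy: "missed y (x # R @ z # S @ w # T)"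
    using missed_swap[of x "[]" y "R @ z # S @ w # T"] C na by simp
  have Cz: "missed z (y # R @ x # S @ w # T)"
    using missed_swap[of x "y # R" z "S @ w # T"] C na by simp
  have Cw: "missed w (x # R @ z # S @ y # T)"
    using missed_swap[of y "x # R @ z # S" w T] Cy na by simp
  note A = missed_arcs[OF C]
  have ne: "R \<noteq> []" "T \<noteq> []"
    using A missed_xor[OF C] na by (auto simp: junctions)
  have mem: "x \<in> V" "y \<in> V" "z \<in> V" "w \<in> V" "distinct [x, y, z, w]"
    using C by (auto simp: ham_cycle_on_def)
  have yz: "E y z \<or> E z y"
    using nonadj_clique[of x _ y z] C mem na by auto
  have xw: "E x w \<or> E w x"
    using nonadj_clique[of y _ x w] Cy mem na by auto
  note facts = A missed_xor[OF C] missed_xor[OF Cy] missed_xor[OF Cz] missed_xor[OF Cw]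
    na yz xw
  note arc_simps = junctions ne S
  have zw: "\<not> E z w"
    using no_ham_rearrangement[OF C, of "x # S @ y # R @ z # w # T"] facts
    by (simp (no_asm_use) add: arc_simps) sat
  have wz: "\<not> (E x w \<and> \<not> E w z)"
    using no_ham_rearrangement[OF C, of "x # w # S @ y # R @ z # T"] facts zw
    by (simp (no_asm_use) add: arc_simps) sat
  have zy: "\<not> (\<not> E x w \<and> E z y)"
    using no_ham_rearrangement[OF C, of "x # S @ w # R @ z # y # T"] facts
    by (simp (no_asm_use) add: arc_simps) sat
  have wx: "\<not> (\<not> E w x \<and> E w z)"
    using no_ham_rearrangement[OF C, of "x # T @ w # z # S @ y # R"] facts
    by (simp (no_asm_use) add: arc_simps) sat
  have yz': "\<not> (E x w \<and> \<not> E y z)"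
    using no_ham_rearrangement[OF C, of "x # w # S @ z # R @ y # T"] facts zw
    by (simp (no_asm_use) add: arc_simps) sat
  have zy': "\<not> (E x w \<and> \<not> E z y)"
    using no_ham_rearrangement[OF C, of "x # w # T @ z # S @ y # R"] facts
    by (simp (no_asm_use) add: arc_simps) sat
  have wz': "\<not> (\<not> E w z \<and> \<not> E z y \<and> E w x)"
    using no_ham_rearrangement[OF C, of "x # R @ z # T @ y # S @ [w]"] facts
    by (simp (no_asm_use) add: arc_simps) sat
  show ?thesis
    using zw wz zy wx yz' zy' wz' yz xw by blast
qed

text \<open>The case where nothing lies between \<open>z\<close> and \<open>w\<close>: both arcs
  come from the exactly-one conditions of \<open>x\<close> and \<open>y\<close> at the arc
  \<open>z w\<close>.\<close>

lemma nonadj_path_adjacent: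
  assumes C: "missed x (y # R @ z # w # T)"
    and na: "nonadj x y" "nonadj x z" "nonadj y w"
  shows "E z y \<and> E x w"
proof -
  have Cy: "missed y (x # R @ z # w # T)"
    using missed_swap[of x "[]" y "R @ z # w # T"] C na by simp
  from missed_xor[OF C] missed_xor[OF Cy] na show ?thesis
    by (simp (no_asm_use) add: junctions) sat
qed

lemma nonadj_path_gap_rev:
  assumes C: "missed x (y # R @ w # S @ z # T)" and S: "S \<noteq> []"
    and na: "nonadj x y" "nonadj x z" "nonadj y w"
  shows "E z y \<and> E x w \<and> E z w \<and> \<not> E w z \<and> (E y z \<longleftrightarrow> E w x)"
proof -
  interpret c: nonadjacent_cliques "\<lambda>u v. E v u" V by (rule converse_cliques)
  show ?thesis
    using c.nonadj_path_gap[of x y "rev T" z "rev S" w "rev R"] missed_converse[OF C] S na by simp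
qed

lemma nonadj_path_adjacent_rev:
  assumes C: "missed x (y # R @ w # z # T)"
    and na: "nonadj x y" "nonadj x z" "nonadj y w"
  shows "E y z \<and> E w x"
proof -
  interpret c: nonadjacent_cliques "\<lambda>u v. E v u" V by (rule converse_cliques)
  show ?thesis
    using c.nonadj_path_adjacent[of x y "rev T" z w "rev R"] missed_converse[OF C] na by simp
qed

section \<open>Three non-neighbours are joined by arcs in both directions\<close>

text \<open>Without \<open>a c\<close>, the cycle missing \<open>c\<close> yields an arc from
  \<open>c\<close> to \<open>hd P\<close>, which closes the sequence
  \<open>x S a b Q c P\<close>.\<close>

lemma triple_arc:
  assumes C: "missed x (a # P @ b # Q @ c # S)"
    and na: "nonadj x a" "nonadj x b" "nonadj x c"
    and ab: "E a b"
  shows "E a c"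
proof (rule ccontr)
  assume ac: "\<not> E a c"
  have Ca: "missed a (x # P @ b # Q @ c # S)"
    using missed_swap[of x "[]" a "P @ b # Q @ c # S"] C na by simp
  have Cc: "missed c (a # P @ b # Q @ x # S)"
    using missed_swap[of x "a # P @ b # Q" c S] C na by simp
  note A = missed_arcs[OF C]
  have ne: "P \<noteq> []" "Q \<noteq> []" "S \<noteq> []"
    using A missed_xor[OF C] na by (auto simp: junctions)
  have "mset (x # S @ a # b # Q @ c # P) = mset (x # a # P @ b # Q @ c # S)" by simp
  from no_ham_rearrangement[OF C this] A missed_xor[OF C] missed_xor[OF Ca] missed_xor[OF Cc]
    na ab ac show False
    by (simp (no_asm_use) add: junctions ne) sat
qed

lemma triple_rotate:
  assumes "missed x (a # P @ b # Q @ c # S)"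
  shows "missed x (b # Q @ c # S @ a # P)" "missed x (c # S @ a # P @ b # Q)"
  using missed_rotate[of x "a # P" "b # Q @ c # S"]
    missed_rotate[of x "a # P @ b # Q" "c # S"] assms by simp_all

lemma triple_converse:
  assumes "missed x (a # P @ b # Q @ c # S)"
  shows "x \<in> V \<and>
    ham_cycle_on (\<lambda>u v. E v u) (V - {x}) (a # rev S @ c # rev Q @ b # rev P)"
  using missed_converse[OF assms] by simp

lemma triple_arc':
  assumes C: "missed x (a # P @ b # Q @ c # S)"
    and na: "nonadj x a" "nonadj x b" "nonadj x c"
    and bc: "E b c"
  shows "E a c"
proof -
  interpret c: nonadjacent_cliques "\<lambda>u v. E v u" V by (rule converse_cliques)
  show ?thesis
    using c.triple_arc[of x c "rev Q" b "rev P" a "rev S"]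
      triple_converse[OF triple_rotate(2)[OF C]] na bc by simp
qed

lemma triple_adjacent:
  assumes C: "missed x (a # P @ b # Q @ c # S)"
    and na: "nonadj x a" "nonadj x b"
  shows "E a b \<or> E b a"
proof -
  have "a \<in> V" "b \<in> V" "a \<noteq> x" "b \<noteq> x" "a \<noteq> b"
    using C by (auto simp: ham_cycle_on_def)
  with nonadj_clique[of x _ a b] C na show ?thesis by blast
qed

text \<open>After an exchange \<open>a\<close> is itself missed, so it has a non-neighbour besides
  \<open>x\<close> and the excluded \<open>p\<close>. Being adjacent to \<open>b\<close> and
  \<open>c\<close>, it forces this vertex into the interior of a segment.\<close>

lemma missed_second_nonadj:
  assumes C: "missed x (a # P @ b # Q @ c # S)"
    and na: "nonadj x a" "nonadj x b" "nonadj x c" "E a b \<or> E b a" "E a c \<or> E c a"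
  obtains w where "nonadj a w" "w \<noteq> p" "w \<in> set P \<or> w \<in> set Q \<or> w \<in> set S"
proof -
  have "missed a (x # P @ b # Q @ c # S)"
    using missed_swap[of x "[]" a "P @ b # Q @ c # S"] C na by simp
  then obtain w where w: "w \<in> V" "w \<noteq> a" "w \<noteq> x" "w \<noteq> p" "nonadj a w"
    using third_nonadj[of a _ x p] by blast
  then have "w \<noteq> b" "w \<noteq> c" using na by auto
  moreover have "w \<in> set (a # P @ b # Q @ c # S)" using w C by (simp add: ham_cycle_on_def)
  ultimately show thesis using that[of w] w by auto
qed

text \<open>
  The position of \<open>w\<close> is forced, so at most one such \<open>w\<close> exists, against \<open>third_nonadj\<close>.
\<close>

lemma mixed_nonadj_position:
  assumes C: "missed x (a # P @ b # Q @ c # S)"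
    and na: "nonadj x a" "nonadj x b" "nonadj x c"
    and ab: "\<not> E a b" and ac: "E a c"
    and w: "nonadj a w" "w \<in> set P \<or> w \<in> set Q \<or> w \<in> set S"
  shows "w = hd Q"
  using w(2)
proof (elim disjE)
  assume "w \<in> set P"
  then obtain P1 P2 where P: "P = P1 @ w # P2" by (meson split_list)
  \<comment> \<open>The truth value of \<open>E w x\<close> does not depend on which of
    \<open>b\<close>, \<open>c\<close> plays the role of the other non-neighbour; it would have to
    agree with both \<open>E a b\<close> and \<open>E a c\<close>, which differ.\<close>
  have c: "E a c \<longleftrightarrow> E w x"
    using nonadj_path_gap_rev[of x a P1 w "P2 @ b # Q" c S] C na w by (simp add: P)
  show ?thesis
  proof (cases "P2 = []")
    case True
    then show ?thesis
      using nonadj_path_adjacent_rev[of x a P1 w b "Q @ c # S"] C na w ab by (simp add: P)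
  next
    case False
    then show ?thesis
      using nonadj_path_gap_rev[of x a P1 w P2 b "Q @ c # S"] C na w ab ac c by (simp add: P)
  qed
next
  assume "w \<in> set Q"
  then obtain Q1 Q2 where Q: "Q = Q1 @ w # Q2" by (meson split_list)
  show ?thesis
  proof (cases "Q1 = []")
    case False
    then show ?thesis
      using nonadj_path_gap[of x a P b Q1 w "Q2 @ c # S"] C na w ab by (simp add: Q)
  qed (simp add: Q)
next
  assume "w \<in> set S"
  then obtain S1 S2 where S: "S = S1 @ w # S2" by (meson split_list)
  show ?thesis
    using nonadj_path_gap[of x a P b "Q @ c # S1" w S2] C na w ab by (simp add: S)
qed

text \<open>Otherwise \<open>hd Q\<close> would be the only non-neighbour of \<open>a\<close> inside
  the segments, whereas a further one exists.\<close>

lemma not_mixed: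
  assumes C: "missed x (a # P @ b # Q @ c # S)"
    and na: "nonadj x a" "nonadj x b" "nonadj x c"
    and ac: "E a c"
  shows "E a b"
proof (rule ccontr)
  assume ab: "\<not> E a b"
  have "E b a" using triple_adjacent[OF C] na ab by blast
  then obtain w where w: "nonadj a w" "w \<noteq> hd Q" "w \<in> set P \<or> w \<in> set Q \<or> w \<in> set S"
    using missed_second_nonadj[OF C na, of "hd Q"] ac by blast
  then show False using mixed_nonadj_position[OF C na ab ac] by blast
qed

text \<open>If only \<open>b a\<close> were present, \<open>not_mixed\<close> for the order
  \<open>b\<close>, \<open>c\<close>, \<open>a\<close> would give \<open>b c\<close>, then
  \<open>triple_arc'\<close> gives \<open>a c\<close>, and \<open>not_mixed\<close> gives
  \<open>a b\<close> after all.\<close>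

lemma triple_first_arc:
  assumes C: "missed x (a # P @ b # Q @ c # S)"
    and na: "nonadj x a" "nonadj x b" "nonadj x c"
  shows "E a b"
  using not_mixed[OF C] not_mixed[OF triple_rotate(1)[OF C]] triple_arc'[OF C]
    triple_adjacent[OF C] na by blast

text \<open>Rotation yields the three arcs in cyclic order; \<open>triple_arc\<close> turns each of
  them into the arc from the same tail to the third vertex.\<close>

lemma triple_all_arcs:
  assumes C: "missed x (a # P @ b # Q @ c # S)"
    and na: "nonadj x a" "nonadj x b" "nonadj x c"
  shows "E a b" "E b c" "E c a" "E b a" "E c b" "E a c"
proof -
  note R = triple_rotate[OF C]
  show 1: "E a b" "E b c" "E c a"
    using triple_first_arc[OF C] triple_first_arc[OF R(1)] triple_first_arc[OF R(2)] na by blast+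
  show "E a c" "E b a" "E c b"
    using triple_arc[OF C] triple_arc[OF R(1)] triple_arc[OF R(2)] na 1 by blast+
qed

section \<open>Locating the non-neighbours of \<open>a\<close> between \<open>b\<close> and
  \<open>c\<close>\<close>

text \<open>The first closed sequence excludes \<open>d c\<close>; by the exactly-one condition for
  \<open>c\<close> there is then an arc from \<open>c\<close> to \<open>hd N\<close>, which the
  second sequence uses.\<close>

lemma nonadj_after_b_gap:
  assumes C: "missed x (a # P @ b # d # N @ c # S)"
    and na: "nonadj x a" "nonadj x b" "nonadj x c" "nonadj a d"
  shows "N = []"
proof (rule ccontr)
  assume N: "N \<noteq> []"
  have Ca: "missed a (x # P @ b # d # N @ c # S)"
    using missed_swap[of x "[]" a "P @ b # d # N @ c # S"] C na by simp
  have Cb: "missed b (a # P @ x # d # N @ c # S)"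
    using missed_swap[of x "a # P" b "d # N @ c # S"] C na by simp
  have Cc: "missed c (a # P @ b # d # N @ x # S)"
    using missed_swap[of x "a # P @ b # d # N" c S] C na by simp
  have Cd: "missed d (x # P @ b # a # N @ c # S)"
    using missed_swap[of a "x # P @ [b]" d "N @ c # S"] Ca na by simp
  note A = missed_arcs[OF C]
  note K = triple_all_arcs[of x a P b "d # N" c S, simplified, OF C[simplified] na(1-3)[simplified]]
  have ne: "P \<noteq> []" "S \<noteq> []"
    using A missed_xor[OF C] na by (auto simp: junctions)
  note facts = A missed_xor[OF C] missed_xor[OF Ca] missed_xor[OF Cb] missed_xor[OF Cc]
    missed_xor[OF Cd] na K
  have "\<not> E d c"
    using no_ham_rearrangement[OF C, of "x # P @ b # d # c # S @ a # N"] facts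
    by (simp (no_asm_use) add: junctions ne N) sat
  then show False
    using no_ham_rearrangement[OF C, of "x # d # S @ a # P @ b # c # N"] facts
    by (simp (no_asm_use) add: junctions ne N) sat
qed

text \<open>An arc \<open>w c\<close> closes a Hamiltonian cycle. It is forced if \<open>M\<close>
  is nonempty; if \<open>M\<close> is empty, its absence gives an arc from \<open>c\<close> to
  \<open>hd N\<close> and with it another Hamiltonian cycle.\<close>

lemma no_second_nonadj_after_c:
  assumes C: "missed x (a # P @ b # d # c # M @ w # N)"
    and na: "nonadj x a" "nonadj x b" "nonadj x c" "nonadj a d" "nonadj a w"
  shows False
proof -
  have Ca: "missed a (x # P @ b # d # c # M @ w # N)"
    using missed_swap[of x "[]" a "P @ b # d # c # M @ w # N"] C na by simp
  have Cc: "missed c (a # P @ b # d # x # M @ w # N)"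
    using missed_swap[of x "a # P @ [b, d]" c "M @ w # N"] C na by simp
  have Cd: "missed d (x # P @ b # a # c # M @ w # N)"
    using missed_swap[of a "x # P @ [b]" d "c # M @ w # N"] Ca na by simp
  note A = missed_arcs[OF C]
  note K = triple_all_arcs[of x a P b "[d]" c "M @ w # N", simplified,
      OF C[simplified] na(1-3)[simplified]]
  have ne: "P \<noteq> []" "N \<noteq> []"
    using A missed_xor[OF C] na by (auto simp: junctions)
  have "E w b"
    using nonadj_path_gap[of x a P b "d # c # M" w N] C na by simp
  note facts = A missed_xor[OF C] missed_xor[OF Ca] missed_xor[OF Cc] missed_xor[OF Cd] na K this
  show False
  proof (cases "M = []")
    case False
    have "E w c"
      using nonadj_path_gap[of x a "P @ [b, d]" c M w N] C na False by simp
    then show False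
      using no_ham_rearrangement[OF C, of "x # P @ b # d # M @ w # c # a # N"] facts
      by (simp (no_asm_use) add: junctions ne False) sat
  next
    case True
    have "\<not> E w c"
      using no_ham_rearrangement[OF C, of "x # P @ b # d # w # c # a # N"] facts
      by (simp (no_asm_use) add: junctions ne True) sat
    then show False
      using no_ham_rearrangement[OF C, of "x # d # w # b # c # N @ a # P"] facts
      by (simp (no_asm_use) add: junctions ne True) sat
  qed
qed

lemma nonadj_inner:
  assumes C: "missed x (a # P @ b # Q1 @ d # Q2 @ c # S)"
    and na: "nonadj x a" "nonadj x b" "nonadj x c" "nonadj a d"
  shows "Q1 \<noteq> [] \<and> Q2 \<noteq> []"
proof (rule ccontr)
  interpret c: nonadjacent_cliques "\<lambda>u v. E v u" V by (rule converse_cliques)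
  assume "\<not> ?thesis"
  moreover have "Q1 = [] \<Longrightarrow> Q2 = []"
    using nonadj_after_b_gap[of x a P b d Q2 c S] C na by simp
  moreover have "Q2 = [] \<Longrightarrow> Q1 = []"
    using c.nonadj_after_b_gap[of x a "rev S" c d "rev Q1" b "rev P"] missed_converse[OF C] na
    by simp
  \<comment> \<open>An empty gap on one side of \<open>d\<close> empties the other side too. So
    \<open>d\<close> alone separates \<open>b\<close> from \<open>c\<close>, and a second
    non-neighbour of \<open>a\<close> must lie in \<open>P\<close> or \<open>S\<close>.\<close>
  ultimately have Q: "Q1 = []" "Q2 = []" by auto
  then have C': "missed x (a # P @ b # [d] @ c # S)" using C by simp
  have "E a b" "E a c"
    using triple_all_arcs[OF C'] na by blast+
  then obtain w where w: "nonadj a w" "w \<noteq> d" "w \<in> set P \<or> w \<in> set [d] \<or> w \<in> set S"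
    using missed_second_nonadj[OF C' na(1-3), of d] by blast
  then have "w \<in> set P \<or> w \<in> set S" by auto
  then show False
  proof
    assume "w \<in> set S"
    then obtain M N where "S = M @ w # N" by (meson split_list)
    then show False
      using no_second_nonadj_after_c[of x a P b d c M w N] C' na w by simp
  next
    assume "w \<in> set P"
    then obtain N M where "P = N @ w # M" by (meson split_list)
    then show False
      using c.no_second_nonadj_after_c[of x a "rev S" c d b "rev M" w "rev N"]
        missed_converse[OF C'] na w by simp
  qed
qed

text \<open>Both \<open>b a\<close> and \<open>a c\<close> are arcs, so \<open>E a\<close> is false
  just after \<open>b\<close> and true at \<open>c\<close>; the rise in between exhibits
  \<open>d\<close>.\<close>

lemma nonadj_between:
  assumes C: "missed x (a # P @ b # Q @ c # S)"
    and na: "nonadj x a" "nonadj x b" "nonadj x c"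
  obtains Q1 d Q2 where "Q = Q1 @ d # Q2" "nonadj a d" "Q1 \<noteq> []" "Q2 \<noteq> []"
proof -
  note K = triple_all_arcs[OF C na]
  have Ca: "missed a (x # P @ b # Q @ c # S)"
    using missed_swap[of x "[]" a "P @ b # Q @ c # S"] C na by simp
  have "successively (\<lambda>u w. E u a \<noteq> E a w) ((x # P) @ (b # Q @ [c]) @ S)"
    using missed_xor[OF Ca] by simp
  then have X: "successively (\<lambda>u w. E u a \<noteq> E a w) (b # Q @ [c])"
    unfolding successively_append_iff by blast
  have "successively (\<lambda>u w. E u a \<noteq> E a w) (Q @ [c])" "\<not> E a (hd (Q @ [c]))"
    using X K by (simp_all add: successively_Cons)
  from successively_xor_rise[OF this K(6)]
  obtain Q1 d Q2 where Q: "Q = Q1 @ d # Q2" "nonadj a d" by blast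
  then show thesis using that nonadj_inner[of x a P b Q1 d Q2 c S] C na by simp
qed

section \<open>The final Hamiltonian cycle\<close>

lemma not_missed: "\<not> missed x xs"
proof
  assume C0: "missed x xs"
  obtain a where a: "a \<in> V" "a \<noteq> x" "nonadj x a" using third_nonadj C0 by blast
  obtain b where b: "b \<in> V" "b \<noteq> x" "b \<noteq> a" "nonadj x b" using third_nonadj C0 by blast
  obtain c where c: "c \<in> V" "c \<noteq> x" "c \<noteq> a" "c \<noteq> b" "nonadj x c" using third_nonadj C0 by blast
  \<comment> \<open>The cyclic order of the three vertices is unknown, so \<open>b\<close> and
    \<open>c\<close> may have to be interchanged.\<close>
  have "\<exists>b c P Q S. missed x (a # P @ b # Q @ c # S) \<and> nonadj x b \<and> nonadj x c"
    using ham_cycle_on_split3[of E "V - {x}" xs a b c] C0 a b c by (metis Diff_iff singletonD)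
  then obtain b c P Q S where C: "missed x (a # P @ b # Q @ c # S)"
    and na: "nonadj x a" "nonadj x b" "nonadj x c" using a by blast
  note R = triple_rotate[OF C]
  obtain Q1 d Q2 where Q: "Q = Q1 @ d # Q2" "nonadj a d" "Q1 \<noteq> []" "Q2 \<noteq> []"
    using nonadj_between[OF C na] .
  obtain S1 e S2 where S: "S = S1 @ e # S2" "nonadj b e" "S1 \<noteq> []" "S2 \<noteq> []"
    using nonadj_between[OF R(1) na(2,3,1)] .
  obtain P1 f P2 where P: "P = P1 @ f # P2" "nonadj c f" "P1 \<noteq> []" "P2 \<noteq> []"
    using nonadj_between[OF R(2) na(3,1,2)] .
  have Ca: "missed a (x # P @ b # Q @ c # S)"
    using missed_swap[of x "[]" a "P @ b # Q @ c # S"] C na by simp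
  have Cb: "missed b (a # P @ x # Q @ c # S)"
    using missed_swap[of x "a # P" b "Q @ c # S"] C na by simp
  have Cc: "missed c (a # P @ b # Q @ x # S)"
    using missed_swap[of x "a # P @ b # Q" c S] C na by simp
  have Cd: "missed d (x # P @ b # Q1 @ a # Q2 @ c # S)"
    using missed_swap[of a "x # P @ b # Q1" d "Q2 @ c # S"] Ca Q by simp
  have Ce: "missed e (a # P @ x # Q @ c # S1 @ b # S2)"
    using missed_swap[of b "a # P @ x # Q @ c # S1" e S2] Cb S by simp
  have Cf: "missed f (a # P1 @ c # P2 @ b # Q @ x # S)"
    using missed_swap[of c "a # P1" f "P2 @ b # Q @ x # S"] Cc P by simp
  note K = triple_all_arcs[OF C na]
  have d: "\<not> E b d" "\<not> E d c"
    using nonadj_path_gap[of x a P b Q1 d "Q2 @ c # S"]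
      nonadj_path_gap_rev[of x a "P @ b # Q1" d Q2 c S] C na Q by simp_all
  have e: "\<not> E c e" "\<not> E e a"
    using nonadj_path_gap[of x b Q c S1 e "S2 @ a # P"]
      nonadj_path_gap_rev[of x b "Q @ c # S1" e S2 a P] R na S by simp_all
  have f: "\<not> E a f" "\<not> E f b" "E x f"
    using nonadj_path_gap[of x c S a P1 f "P2 @ b # Q"]
      nonadj_path_gap_rev[of x c "S @ a # P1" f P2 b Q] R na P by simp_all
  \<comment> \<open>Each of \<open>d\<close>, \<open>e\<close>, \<open>f\<close> splits one segment,
    and the two halves are traversed in exchanged order. Apart from \<open>x f\<close>, every
    junction is forced by a non-adjacency or by one of the excluded arcs in \<open>d\<close>,
    \<open>e\<close>, \<open>f\<close> through an exactly-one condition.\<close>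
  have "mset (x # f # P1 @ a # Q2 @ d # Q1 @ b # S2 @ e # S1 @ c # P2)
      = mset (x # a # P @ b # Q @ c # S)"
    by (simp add: P Q S)
  from no_ham_rearrangement[OF C this] missed_arcs[OF C] missed_xor[OF C] missed_xor[OF Ca]
    missed_xor[OF Cb] missed_xor[OF Cc] missed_xor[OF Cd] missed_xor[OF Ce] missed_xor[OF Cf]
    na Q(2) S(2) P(2) K d e f
  show False unfolding P(1) Q(1) S(1)
    by (simp (no_asm_use) add: junctions P(3,4) Q(3,4) S(3,4)) sat
qed

end

section \<open>From digraphs and degrees to the relational setting\<close>

lemma cycle_of_iff_ham_cycle_on:
  assumes "pair_wf_digraph D"
  shows "cycle_of D xs \<longleftrightarrow> ham_cycle_on (\<lambda>u v. (u, v) \<in> parcs D) (set xs) xs"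
proof (cases "xs = []")
  case False
  let ?E = "\<lambda>u v. (u, v) \<in> parcs D"
  have "(\<forall>i<length xs. ?E (xs ! i) (xs ! ((i + 1) mod length xs))) \<longleftrightarrow>
      (\<forall>i. Suc i < length xs \<longrightarrow> ?E (xs ! i) (xs ! Suc i)) \<and>
      ?E (xs ! (length xs - 1)) (xs ! 0)" (is "?L \<longleftrightarrow> ?R")
  proof
    assume L: ?L
    have "Suc (length xs - 1) = length xs" using False by simp
    with L[rule_format, of "length xs - 1"] have "?E (xs ! (length xs - 1)) (xs ! 0)" by simp
    moreover have "?E (xs ! i) (xs ! Suc i)" if "Suc i < length xs" for i
      using L[rule_format, of i] that by simp
    ultimately show ?R by blast
  next
    assume R: ?R
    show ?L
    proof (intro allI impI)
      fix i assume i: "i < length xs"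
      show "?E (xs ! i) (xs ! ((i + 1) mod length xs))"
      proof (cases "Suc i = length xs")
        case True
        then have "length xs - 1 = i" by simp
        with R True show ?thesis by simp
      next
        case False
        with R i show ?thesis by simp
      qed
    qed
  qed
  then show ?thesis using False
    by (simp add: cycle_of_iff[OF assms] ham_cycle_on_def successively_conv_nth
        last_conv_nth hd_conv_nth)
qed (simp add: cycle_of_iff[OF assms] ham_cycle_on_def)

lemma card_nth_distinct:
  "distinct xs \<Longrightarrow> card {i. i < length xs \<and> R (xs ! i)} = card {u \<in> set xs. R u}"
  by (metis distinct_card distinct_filter length_filter_conv_card set_filter)

text \<open>The positions of in-neighbours of \<open>v\<close> and those whose successor is an
  out-neighbour are disjoint, since \<open>v\<close> cannot be inserted. Each set has at least
  \<open>m\<close> elements among \<open>2 * m\<close> positions, so together they are all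
  positions.\<close>

lemma degree_sum_xor:
  assumes nonham: "\<And>ys. \<not> ham_cycle_on E V ys"
    and C: "v \<in> V" "ham_cycle_on E (V - {v}) xs" and len: "length xs = 2 * m"
    and irrefl: "\<not> E v v"
    and deg: "m \<le> card {w \<in> V. E v w}" "m \<le> card {u \<in> V. E u v}"
  shows "E (last xs) v \<noteq> E v (hd xs)"
proof -
  let ?n = "length xs"
  \<comment> \<open>Through \<open>rotate1\<close>, position \<open>i\<close> in \<open>?J\<close>
    stands for the cyclic successor of \<open>xs ! i\<close>.\<close>
  let ?I = "{i. i < ?n \<and> E (xs ! i) v}" and ?J = "{i. i < length (rotate1 xs) \<and> E v (rotate1 xs ! i)}"
  have xs: "xs \<noteq> []" "distinct xs" "set xs = V - {v}" using C by (auto simp: ham_cycle_on_def)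
  have no_insert: "\<not> (E (last ys) v \<and> E v (hd ys))" if "ham_cycle_on E (V - {v}) ys" for ys
    using nonham[of "v # ys"] that C(1) by (auto simp: ham_cycle_on_def successively_Cons)
  have "?I \<inter> ?J = {}"
  proof (rule ccontr)
    assume "?I \<inter> ?J \<noteq> {}"
    then obtain i where i: "i < ?n" "E (xs ! i) v" "E v (xs ! (Suc i mod ?n))"
      by (auto simp: nth_rotate1)
    have "ham_cycle_on E (V - {v}) (drop (Suc i) xs @ take (Suc i) xs)"
      using C(2) ham_cycle_on_append_commute[of E _ "take (Suc i) xs" "drop (Suc i) xs"] by simp
    note rotated = no_insert[OF this]
    show False
    proof (cases "Suc i = ?n")
      case True
      then have "?n - 1 = i" by simp
      then have "last xs = xs ! i" "hd xs = xs ! (Suc i mod ?n)"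
        using True xs(1) by (simp_all add: last_conv_nth hd_conv_nth)
      then show False using no_insert[OF C(2)] i by simp
    next
      case False
      then have "Suc i < ?n" using i(1) by simp
      then show False using rotated i by (simp add: take_Suc_conv_app_nth hd_drop_conv_nth)
    qed
  qed
  moreover have "card ?I = card {u \<in> V. E u v}" "card ?J = card {w \<in> V. E v w}"
    using card_nth_distinct[of xs "\<lambda>u. E u v"] card_nth_distinct[of "rotate1 xs" "E v"] xs irrefl
    by (auto intro!: arg_cong[where f = card])
  ultimately have "2 * m \<le> card (?I \<union> ?J)"
    using deg card_Un_disjoint[of ?I ?J] by simp
  moreover have sub: "?I \<union> ?J \<subseteq> {..<?n}" by auto
  ultimately have "?I \<union> ?J = {..<?n}"
    using len card_mono[OF _ sub] by (intro card_subset_eq) auto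
  then have "?n - 1 \<in> ?I \<union> ?J" using xs(1) by auto
  then have "E (last xs) v \<or> E v (hd xs)"
    using xs(1) by (auto simp: nth_rotate1 last_conv_nth hd_conv_nth)
  then show ?thesis using no_insert[OF C(2)] by blast
qed

section \<open>Deriving the alternatives\<close>

theorem theorem2:
  fixes D :: "'a pair_pre_digraph" and m :: nat
  assumes "m \<ge> 1"
    and "pair_digraph D"
    and "card (pverts D) = 2*m + 1"
    and "strongly_connected (with_proj D)"
    and "\<exists>xs. cycle_of D xs \<and> length xs = 2*m"
  shows
    "(\<exists>xs. cycle_of D xs \<and>
        {v \<in> pverts D. out_degree (with_proj D) v \<ge> m \<and> in_degree (with_proj D) v \<ge> m} \<subseteq> set xs)
     \<or>
     (digraph_iso (with_proj D) (with_proj D5) \<or> digraph_iso (with_proj D) (with_proj D7) \<or>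
      (\<exists>H \<in> L1 \<union> L2 m. digraph_iso (with_proj D) (with_proj H)))
     \<or>
     ((\<exists>H. spanning H (with_proj D) \<and>
           digraph_iso H (with_proj (star (complete_bipartite_ugraph m (m + 1))))) \<and>
      (\<exists>H. spanning H (with_proj (star (ugraph_join (complete_ugraph m) (edgeless_ugraph (m + 1))))) \<and>
           digraph_iso (with_proj D) H))
     \<or>
     (\<exists>xs x. cycle_of D xs \<and> length xs = 2*m \<and> x \<in> pverts D \<and> x \<notin> set xs \<and>
        nonneighbours_twins D xs x)"
proof -
  interpret pair_digraph D by (rule assms(2))
  have wf: "pair_wf_digraph D" by unfold_locales
  define E where "E = (\<lambda>u v. (u, v) \<in> parcs D)"
  define V where "V = pverts D"
  have E_V: "u \<in> V" "v \<in> V" if "E u v" for u v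
    using that in_arcsD1 in_arcsD2 by (auto simp: E_def V_def)
  have cyc: "cycle_of D xs \<longleftrightarrow> ham_cycle_on E (set xs) xs" for xs
    unfolding E_def by (rule cycle_of_iff_ham_cycle_on[OF wf])
  have cycle_missing: "cycle_of D xs \<and> set xs = V - {v} \<and> length xs = 2 * m"
    if "v \<in> V" "ham_cycle_on E (V - {v}) xs" for v xs
  proof -
    have xs: "set xs = V - {v}" "distinct xs" using that by (auto simp: ham_cycle_on_def)
    then have "length xs = 2 * m"
      using distinct_card[of xs] that(1) assms(3) by (simp add: V_def)
    with xs that show ?thesis by (simp add: cyc)
  qed
  show ?thesis
  proof (rule ccontr)
    assume neg: "\<not> ?thesis"
    have no_cover: "\<exists>v\<in>V. m \<le> card (out_nbrs D v) \<and> m \<le> card (in_nbrs D v) \<and> v \<notin> set xs"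
      if "cycle_of D xs" for xs
      using neg that unfolding V_def out_degree_eq_card_out_nbrs in_degree_eq_card_in_nbrs by blast
    have no_twins: "\<not> nonneighbours_twins D xs v"
      if "v \<in> V" "ham_cycle_on E (V - {v}) xs" for v xs
      using neg that cycle_missing[OF that] unfolding V_def by blast
    have nbrs: "out_nbrs D v = {w \<in> V. E v w}" "in_nbrs D v = {u \<in> V. E u v}" for v
      using E_V by (auto simp: out_nbrs_def in_nbrs_def E_def)
    interpret nonhamiltonian E V
    proof
      show irrefl: "\<not> E v v" for v using no_loops' by (auto simp: E_def)
      show nonham: "\<not> ham_cycle_on E V xs" for xs
        using no_cover[of xs] by (auto simp: cyc ham_cycle_on_def)
      show "E (last xs) v \<noteq> E v (hd xs)"
        if v: "v \<in> V" "ham_cycle_on E (V - {v}) xs" for v xs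
      proof -
        \<comment> \<open>The vertex of large degrees that \<open>xs\<close> fails to cover can only
          be \<open>v\<close>.\<close>
        have "m \<le> card (out_nbrs D v)" "m \<le> card (in_nbrs D v)"
          using no_cover[of xs] cycle_missing[OF v] by auto
        then show ?thesis
          using degree_sum_xor[OF nonham v _ irrefl] cycle_missing[OF v] by (simp add: nbrs)
      qed
    qed
    have adj: "adjacent D u v \<longleftrightarrow> E u v \<or> E v u" for u v
      by (simp add: adjacent_def E_def)
    interpret nonadjacent_cliques E V
    proof
      fix v :: 'a and xs and p q :: 'a
      assume v: "v \<in> V" "ham_cycle_on E (V - {v}) xs"
      note xs = cycle_missing[OF v]
      \<comment> \<open>Since the twin property fails, it is not vacuous: there is a set of at least
        three non-neighbours, one of which avoids \<open>p\<close> and \<open>q\<close>.\<close>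
      obtain I where I: "I \<subseteq> {..<length xs}" "3 \<le> card I" "\<forall>l\<in>I. \<not> adjacent D v (xs ! l)"
        using no_twins[OF v] unfolding nonneighbours_twins_def by blast
      have "inj_on ((!) xs) I"
        using I(1) v by (intro inj_on_nth) (auto simp: ham_cycle_on_def)
      then have "3 \<le> card ((!) xs ` I)" using I(2) by (simp add: card_image)
      moreover have "card {p, q} \<le> 2" by (simp add: card_insert_if)
      ultimately have "\<not> (!) xs ` I \<subseteq> {p, q}"
        using card_mono[of "{p, q}" "(!) xs ` I"] by auto
      then obtain l where l: "l \<in> I" "xs ! l \<noteq> p" "xs ! l \<noteq> q" by auto
      then have "xs ! l \<in> V - {v}" using I(1) xs nth_mem[of l xs] by auto
      then show "\<exists>w\<in>V. w \<noteq> v \<and> w \<noteq> p \<and> w \<noteq> q \<and> nonadj v w"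
        using l I(3) adj by blast
    next
      fix v xs u w
      assume v: "v \<in> V" "ham_cycle_on E (V - {v}) xs"
        and u: "u \<in> V" "w \<in> V" "u \<noteq> v" "w \<noteq> v" "u \<noteq> w" "nonadj v u" "nonadj v w"
      note xs = cycle_missing[OF v]
      show "E u w \<or> E w u"
      proof (rule ccontr)
        assume uw: "\<not> ?thesis"
        \<comment> \<open>A non-adjacent pair of non-neighbours would establish the twin property
          for \<open>xs\<close>, hence alternative (iv).\<close>
        have twins: "(E v t \<longleftrightarrow> E z t) \<and> (E t v \<longleftrightarrow> E t z)"
          if "z \<in> V" "z \<noteq> v" "nonadj v z" for z t
          using nonadj_pair_twins[of v xs u w z t] v u uw that E_V by blast
        have "nonneighbours_twins D xs v"
          unfolding nonneighbours_twins_def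
        proof (intro allI impI)
          fix I assume I: "I \<subseteq> {..<length xs}"
            "3 \<le> card I \<and> (\<forall>l\<in>I. \<not> adjacent D v (xs ! l))"
          have na: "l < length xs" "xs ! l \<in> V" "xs ! l \<noteq> v" "nonadj v (xs ! l)" if "l \<in> I" for l
            using that I xs nth_mem[of l xs] adj by auto
          have "E (xs ! ((l + length xs - 1) mod length xs)) v \<and>
              E v (xs ! ((l + 1) mod length xs))" if "l \<in> I" for l
          proof -
            let ?n = "length xs" and ?p = "(l + length xs - 1) mod length xs"
            have "?p < ?n" using na(1)[OF that] by (intro mod_less_divisor) auto
            moreover have "(?p + 1) mod ?n = l"
            proof -
              have "Suc (l + ?n - 1) = l + ?n" using na(1)[OF that] by simp
              then show ?thesis using na(1)[OF that] by (simp add: mod_Suc_eq)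
            qed
            ultimately show ?thesis
              using missed_xor_nth[of v xs ?p] missed_xor_nth[of v xs l] v na[OF that] by auto
          qed
          moreover have "out_nbrs D v = out_nbrs D (xs ! l)" "in_nbrs D v = in_nbrs D (xs ! l)"
            if "l \<in> I" for l
            using twins[of "xs ! l"] na[OF that] by (auto simp: nbrs)
          moreover have "independent_in D (insert v ((!) xs ` I))"
            unfolding independent_in_def adj
          proof (intro conjI ballI impI)
            show "insert v ((!) xs ` I) \<subseteq> pverts D" using v na by (auto simp: V_def)
            show "\<not> (E p q \<or> E q p)"
              if "p \<in> insert v ((!) xs ` I)" "q \<in> insert v ((!) xs ` I)" "p \<noteq> q" for p q
              \<comment> \<open>Replacing one of the two vertices by its twin \<open>v\<close>
                reduces an arc between them to an arc between \<open>v\<close> and a non-neighbour,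
                or to a loop.\<close>
              using that twins[of p q] twins[of q p] na irrefl by blast
          qed
          ultimately show "(\<forall>l\<in>I. (xs ! ((l + length xs - 1) mod length xs), v) \<in> parcs D \<and>
              (v, xs ! ((l + 1) mod length xs)) \<in> parcs D \<and>
              out_nbrs D v = out_nbrs D (xs ! l) \<and> in_nbrs D v = in_nbrs D (xs ! l)) \<and>
            independent_in D (insert v ((!) xs ` I))"
            unfolding E_def by blast
        qed
        with no_twins[OF v] show False ..
      qed
    qed
    obtain xs where xs: "cycle_of D xs" "length xs = 2 * m" using assms(5) by blast
    then have dist: "distinct xs" and "\<And>i. i < length xs \<Longrightarrow> E (xs ! i) (xs ! ((i + 1) mod length xs))"
      by (auto simp: cycle_of_iff[OF wf] E_def)
    then have sub: "set xs \<subseteq> V" using E_V(1) by (metis in_set_conv_nth subsetI)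
    \<comment> \<open>The given cycle of length \<open>2 * m\<close> misses exactly one vertex,
      which \<open>not_missed\<close> forbids.\<close>
    have "card (V - set xs) = 1"
      using sub dist xs(2) assms(3) by (simp add: V_def card_Diff_subset distinct_card)
    then obtain v where "V - set xs = {v}" by (auto simp: card_1_singleton_iff)
    then have "v \<in> V" "set xs = V - {v}" using sub by auto
    then show False using not_missed[of v xs] xs(1) by (simp add: cyc)
  qed
qed

end
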